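(* Let $G$ be a finitely generated group of stable subexponential growth and let $N$ be a normal subgroup of finite index in $G$. Then $\mathrm{cr}_X(G)\leqslant \mathrm{dc}(G/N)$ for every finite generating set $X$ of $G$.
   Context: For a group $G$ with finite generating set $X$, $\mathbb{B}_{G,X}(n)$ is the ball of radius $n$ about the identity for the word length over $X\cup X^{-1}$, and $C_{G,X}(n)$ is the set of conjugacy classes of $G$ having a representative in $\mathbb{B}_{G,X}(n)$. The conjugacy ratio is $\mathrm{cr}_X(G)=\limsup_{n\to\infty}\frac{|C_{G,X}(n)|}{|\mathbb{B}_{G,X}(n)|}$. The group $G$ with finite generating set $X$ is of stable subexponential growth if $\lim_{n\to\infty}\frac{|\mathbb{B}_{G,X}(n+1)|}{|\mathbb{B}_{G,X}(n)|}=1$. This condition is understood with respect to the generating set $X$ used in the conjugacy ratio, i.e. the claim is for every finite generating set $X$ for which the condition holds. For a finite group $F$, the degree of commutativity is $\mathrm{dc}(F)=\frac{|\{(x,y)\in F\times F: xy=yx\}|}{|F|^2}$. *)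

theory Defs
  imports "HOL-Analysis.Analysis" "HOL-Algebra.Algebra"
begin

definition generating_set :: "('a, 'b) monoid_scheme \<Rightarrow> 'a set \<Rightarrow> bool"
  where "generating_set G S \<longleftrightarrow> S \<subseteq> carrier G \<and> generate G S = carrier G"

text \<open>The least length of a word over \<open>S \<union> S\<inverse>\<close> that represents \<open>g\<close>. It is meaningful only for
  \<open>g\<close> in the subgroup generated by \<open>S\<close>; for other \<open>g\<close> the value is unspecified.\<close>

definition word_length :: "('a, 'b) monoid_scheme \<Rightarrow> 'a set \<Rightarrow> 'a \<Rightarrow> nat"
  where "word_length G S g =
    (LEAST n. \<exists>ws. set ws \<subseteq> S \<union> m_inv G ` S \<and> length ws = n \<and>
       foldr (\<otimes>\<^bsub>G\<^esub>) ws \<one>\<^bsub>G\<^esub> = g)"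

definition word_ball :: "('a, 'b) monoid_scheme \<Rightarrow> 'a set \<Rightarrow> nat \<Rightarrow> 'a set"
  where "word_ball G S n = {g \<in> carrier G. word_length G S g \<le> n}"

definition conjugacy_classes :: "('a, 'b) monoid_scheme \<Rightarrow> 'a set set"
  where "conjugacy_classes G =
    orbits G (carrier G) (\<lambda>g. \<lambda>x \<in> carrier G. g \<otimes>\<^bsub>G\<^esub> x \<otimes>\<^bsub>G\<^esub> inv\<^bsub>G\<^esub> g)"

definition classes_meeting_ball :: "('a, 'b) monoid_scheme \<Rightarrow> 'a set \<Rightarrow> nat \<Rightarrow> 'a set set"
  where "classes_meeting_ball G S n = {C \<in> conjugacy_classes G. C \<inter> word_ball G S n \<noteq> {}}"

text \<open>Valued in \<open>ereal\<close>, where every sequence has a limit superior.\<close>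

definition conjugacy_ratio :: "('a, 'b) monoid_scheme \<Rightarrow> 'a set \<Rightarrow> ereal"
  where "conjugacy_ratio G S =
    limsup (\<lambda>n. ereal (real (card (classes_meeting_ball G S n)) / real (card (word_ball G S n))))"

definition stable_subexp_growth :: "('a, 'b) monoid_scheme \<Rightarrow> 'a set \<Rightarrow> bool"
  where "stable_subexp_growth G S \<longleftrightarrow>
    (\<lambda>n. real (card (word_ball G S (n + 1))) / real (card (word_ball G S n))) \<longlonglongrightarrow> 1"

definition degree_of_commutativity :: "('a, 'b) monoid_scheme \<Rightarrow> real"
  where "degree_of_commutativity F =
    real (card {(x, y). x \<in> carrier F \<and> y \<in> carrier F \<and> x \<otimes>\<^bsub>F\<^esub> y = y \<otimes>\<^bsub>F\<^esub> x})
      / real (order F) ^ 2"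

end

theory Submission
  imports Defs
begin

text \<open>Let \<open>F = G/N\<close> and let \<open>r\<close> bound the lengths of representatives of all cosets and of their
  inverses. Translating by these representatives embeds \<open>B(n) \<inter> gN\<close> into \<open>B(n + r) \<inter> hN\<close> for all
  \<open>g\<close> and \<open>h\<close>, so every coset contains at most \<open>|B(n + r)| / |F|\<close> elements of \<open>B(n)\<close>. Choose one
  coset in each conjugacy class of \<open>F\<close>. A conjugacy class of \<open>G\<close> that meets \<open>B(n)\<close> meets a chosen
  coset inside \<open>B(n + 2r)\<close>. Hence \<open>|C(n)| \<le> k |B(n + 3r)| / |F|\<close>, where \<open>k\<close> is the number of
  conjugacy classes of \<open>F\<close>. By Burnside's lemma \<open>k / |F| = dc(F)\<close>, and \<open>|B(n + 3r)| / |B(n)| \<rightarrow> 1\<close>.\<close>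

section \<open>Words, balls and growth\<close>

context group
begin

lemma foldr_mult_closed:
  assumes "set ws \<subseteq> carrier G"
  shows "foldr (\<otimes>) ws \<one> \<in> carrier G"
  using assms by (induction ws) auto

lemma foldr_mult_append:
  assumes "set vs \<subseteq> carrier G" "set ws \<subseteq> carrier G"
  shows "foldr (\<otimes>) (vs @ ws) \<one> = foldr (\<otimes>) vs \<one> \<otimes> foldr (\<otimes>) ws \<one>"
  using assms by (induction vs) (auto simp: foldr_mult_closed m_assoc simp del: foldr_append)

lemma generate_imp_word:
  assumes "S \<subseteq> carrier G" "g \<in> generate G S"
  shows "\<exists>ws. set ws \<subseteq> S \<union> m_inv G ` S \<and> foldr (\<otimes>) ws \<one> = g"
  using assms(2)
proof induction
  case one
  show ?case by (intro exI[of _ "[]"]) simp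
next
  case (incl h)
  then show ?case using assms(1) by (intro exI[of _ "[h]"]) auto
next
  case (inv h)
  then show ?case using assms(1) by (intro exI[of _ "[inv h]"]) auto
next
  case (eng g h)
  then obtain vs ws where "set vs \<subseteq> S \<union> m_inv G ` S" "foldr (\<otimes>) vs \<one> = g"
    "set ws \<subseteq> S \<union> m_inv G ` S" "foldr (\<otimes>) ws \<one> = h" by blast
  moreover from this have "set vs \<subseteq> carrier G" "set ws \<subseteq> carrier G"
    using assms(1) by auto
  ultimately show ?case
    by (intro exI[of _ "vs @ ws"]) (simp add: foldr_mult_append del: foldr_append)
qed

text \<open>Since \<open>S\<close> generates, some word represents \<open>g\<close>; the minimum in
  \<open>word_length\<close> is thus over a nonempty set and is reached.\<close>

lemma word_length_attained:
  assumes "generating_set G S" "g \<in> carrier G"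
  obtains ws where "set ws \<subseteq> S \<union> m_inv G ` S" "length ws = word_length G S g"
    "foldr (\<otimes>) ws \<one> = g"
proof -
  have "\<exists>n ws. set ws \<subseteq> S \<union> m_inv G ` S \<and> length ws = n \<and> foldr (\<otimes>) ws \<one> = g"
    using assms generate_imp_word[of S g] by (auto simp: generating_set_def)
  from LeastI_ex[OF this] show thesis
    using that unfolding word_length_def by blast
qed

text \<open>A short word suffices here, not a shortest one, so that products can be treated by
  concatenating words.\<close>

lemma mem_word_ball_iff:
  assumes "generating_set G S"
  shows "g \<in> word_ball G S n \<longleftrightarrow>
    (\<exists>ws. set ws \<subseteq> S \<union> m_inv G ` S \<and> length ws \<le> n \<and> foldr (\<otimes>) ws \<one> = g)" (is "_ \<longleftrightarrow> ?R")
proof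
  assume "g \<in> word_ball G S n"
  then have g: "g \<in> carrier G" "word_length G S g \<le> n" by (auto simp: word_ball_def)
  with word_length_attained[OF assms g(1)] show ?R by metis
next
  assume ?R
  then obtain ws where ws: "set ws \<subseteq> S \<union> m_inv G ` S" "length ws \<le> n" "foldr (\<otimes>) ws \<one> = g"
    by blast
  have "word_length G S g \<le> length ws"
    unfolding word_length_def using ws by (intro Least_le) blast
  moreover have "g \<in> carrier G"
    using ws assms foldr_mult_closed[of ws] by (auto simp: generating_set_def)
  ultimately show "g \<in> word_ball G S n"
    using ws by (simp add: word_ball_def)
qed

lemma word_ball_subset_carrier: "word_ball G S n \<subseteq> carrier G"
  by (auto simp: word_ball_def)

lemma finite_word_ball:
  assumes "generating_set G S" "finite S"
  shows "finite (word_ball G S n)"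
\<comment> \<open>Evaluation maps the words of length at most \<open>n\<close> over a finite
  alphabet onto the ball.\<close>
proof (rule finite_surj)
  show "finite {ws. set ws \<subseteq> S \<union> m_inv G ` S \<and> length ws \<le> n}"
    using assms(2) by (intro finite_lists_length_le) auto
  show "word_ball G S n \<subseteq> (\<lambda>ws. foldr (\<otimes>) ws \<one>) ` {ws. set ws \<subseteq> S \<union> m_inv G ` S \<and> length ws \<le> n}"
    by (auto simp: mem_word_ball_iff[OF assms(1)])
qed

lemma one_mem_word_ball:
  assumes "generating_set G S"
  shows "\<one> \<in> word_ball G S n"
  unfolding mem_word_ball_iff[OF assms] by (intro exI[of _ "[]"]) simp

lemma mult_mem_word_ball:
  assumes "generating_set G S" "g \<in> word_ball G S m" "h \<in> word_ball G S n"
  shows "g \<otimes> h \<in> word_ball G S (m + n)"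
proof -
  obtain vs ws where w: "set vs \<subseteq> S \<union> m_inv G ` S" "length vs \<le> m" "foldr (\<otimes>) vs \<one> = g"
    "set ws \<subseteq> S \<union> m_inv G ` S" "length ws \<le> n" "foldr (\<otimes>) ws \<one> = h"
    using assms mem_word_ball_iff by metis
  moreover from this have "set vs \<subseteq> carrier G" "set ws \<subseteq> carrier G"
    using assms(1) by (auto simp: generating_set_def)
  ultimately show ?thesis
    unfolding mem_word_ball_iff[OF assms(1)]
    by (intro exI[of _ "vs @ ws"]) (simp add: foldr_mult_append del: foldr_append)
qed

lemma card_word_ball_pos:
  assumes "generating_set G S" "finite S"
  shows "0 < card (word_ball G S n)"
  using finite_word_ball[OF assms] one_mem_word_ball[OF assms(1)] by (metis card_gt_0_iff empty_iff)

text \<open>Telescoping: the ratio is a product of \<open>m\<close> ratios of consecutive balls,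
  each of which tends to 1.\<close>

lemma stable_subexp_growth_shift:
  assumes "generating_set G S" "finite S" "stable_subexp_growth G S"
  shows "(\<lambda>n. real (card (word_ball G S (n + m))) / real (card (word_ball G S n))) \<longlonglongrightarrow> 1"
proof (induction m)
  case 0
  \<comment> \<open>The identity lies in every ball, so this is never the default value
    \<open>0 / 0 = 0\<close>.\<close>
  have "real (card (word_ball G S n)) / real (card (word_ball G S n)) = 1" for n
    using card_word_ball_pos[OF assms(1,2), of n] by simp
  then show ?case by simp
next
  case (Suc m)
  let ?b = "\<lambda>n. real (card (word_ball G S n))"
  have "(\<lambda>n. ?b (n + m + 1) / ?b (n + m)) \<longlonglongrightarrow> 1"
    using assms(3) unfolding stable_subexp_growth_def by (rule LIMSEQ_ignore_initial_segment)
  from tendsto_mult[OF this Suc.IH]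
  have "(\<lambda>n. ?b (n + m + 1) / ?b (n + m) * (?b (n + m) / ?b n)) \<longlonglongrightarrow> 1" by simp
  moreover have "?b (n + m + 1) / ?b (n + m) * (?b (n + m) / ?b n) = ?b (n + Suc m) / ?b n" for n
    using card_word_ball_pos[OF assms(1,2), of "n + m"] by simp
  ultimately show ?case by (simp only:)
qed

section \<open>Conjugacy classes and Burnside's lemma\<close>

lemma conjugacy_class_eq:
  assumes "C \<in> conjugacy_classes G" "x \<in> C"
  shows "C = orbit G (\<lambda>g. \<lambda>x\<in>carrier G. g \<otimes> x \<otimes> inv g) x"
proof -
  interpret conj: group_action G "carrier G" "\<lambda>g. \<lambda>x\<in>carrier G. g \<otimes> x \<otimes> inv g"
    by (rule action_by_conjugation)
  have "x \<in> carrier G"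
    using assms conj.orbits_coverture by (auto simp: conjugacy_classes_def)
  then have "orbit G (\<lambda>g. \<lambda>x\<in>carrier G. g \<otimes> x \<otimes> inv g) x \<in> conjugacy_classes G"
    "x \<in> orbit G (\<lambda>g. \<lambda>x\<in>carrier G. g \<otimes> x \<otimes> inv g) x"
    using conj.orbit_refl by (auto simp: conjugacy_classes_def orbits_def)
  \<comment> \<open>Distinct orbits are disjoint, and both sides are orbits containing
    \<open>x\<close>.\<close>
  then show ?thesis
    using assms conj.disjoint_union[of C] unfolding conjugacy_classes_def by blast
qed

lemma conjugate_mem_class:
  assumes "C \<in> conjugacy_classes G" "x \<in> C" "g \<in> carrier G"
  shows "g \<otimes> x \<otimes> inv g \<in> C"
proof -
  have "x \<in> carrier G"
    using assms group_action.orbits_coverture[OF action_by_conjugation]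
    by (auto simp: conjugacy_classes_def)
  then show ?thesis
    using assms(3) conjugacy_class_eq[OF assms(1,2)] by (auto simp: orbit_def)
qed

lemma conjugacy_class_obtain:
  assumes "x \<in> carrier G"
  obtains C where "C \<in> conjugacy_classes G" "x \<in> C"
  using assms group_action.orbits_coverture[OF action_by_conjugation]
  by (auto simp: conjugacy_classes_def)

lemma class_elements_conjugate:
  assumes "C \<in> conjugacy_classes G" "x \<in> C" "y \<in> C"
  obtains g where "g \<in> carrier G" "y = g \<otimes> x \<otimes> inv g"
proof -
  have "x \<in> carrier G"
    using assms group_action.orbits_coverture[OF action_by_conjugation]
    by (auto simp: conjugacy_classes_def)
  then show thesis
    using that assms(3) conjugacy_class_eq[OF assms(1,2)] by (auto simp: orbit_def)
qed

text \<open>Sort the commuting pairs by first entry \<open>g\<close>: the possible second entries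
  form the centralizer of \<open>g\<close>, which is the fixed-point set of conjugation by
  \<open>g\<close>. Burnside's lemma evaluates the sum of their sizes.\<close>

lemma degree_of_commutativity_eq:
  assumes "finite (carrier G)"
  shows "degree_of_commutativity G = real (card (conjugacy_classes G)) / real (order G)"
proof -
  let ?\<phi> = "\<lambda>g. \<lambda>x\<in>carrier G. g \<otimes> x \<otimes> inv g"
  have inv: "invariants (carrier G) ?\<phi> g = {x \<in> carrier G. g \<otimes> x = x \<otimes> g}"
    if "g \<in> carrier G" for g
    using that by (auto simp: invariants_def inv_solve_right')
  have "{(x, y). x \<in> carrier G \<and> y \<in> carrier G \<and> x \<otimes> y = y \<otimes> x}
      = (SIGMA x:carrier G. {y \<in> carrier G. x \<otimes> y = y \<otimes> x})" by auto
  then have "card {(x, y). x \<in> carrier G \<and> y \<in> carrier G \<and> x \<otimes> y = y \<otimes> x}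
      = (\<Sum>g\<in>carrier G. card (invariants (carrier G) ?\<phi> g))"
    using assms inv by (simp add: card_SigmaI)
  also have "\<dots> = card (conjugacy_classes G) * order G"
    using group_action.burnside[OF action_by_conjugation assms assms]
    by (simp add: conjugacy_classes_def)
  finally show ?thesis
    using assms order_gt_0_iff_finite
    by (simp add: degree_of_commutativity_def power2_eq_square)
qed

end

section \<open>Counting in the fibres of a homomorphism onto a finite group\<close>

text \<open>The fibres of \<open>h\<close> play the role of the cosets of \<open>N\<close>. Right
  translation by an element of length at most \<open>r\<close> moves one fibre to any other, so the
  larger ball contains a disjoint copy of the left-hand set for each point of
  \<open>H\<close>.\<close>

lemma (in group_hom) order_mult_card_ball_fibre_le:
  assumes "generating_set G S" "finite S" "finite (carrier H)"
    and r: "\<And>u. u \<in> carrier H \<Longrightarrow> \<exists>t \<in> word_ball G S r. h t = u"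
    and y: "y \<in> carrier H"
  shows "order H * card {x \<in> word_ball G S n. h x = y} \<le> card (word_ball G S (n + r))"
proof -
  let ?B = "word_ball G S"
  define A where "A z = {x \<in> ?B (n + r). h x = z}" for z
  have fin: "finite (?B m)" for m
    by (rule G.finite_word_ball[OF assms(1,2)])
  have le: "card {x \<in> ?B n. h x = y} \<le> card (A z)" if z: "z \<in> carrier H" for z
  proof -
    \<comment> \<open>With this \<open>t\<close>, an \<open>x\<close> over \<open>y\<close> is moved
      to \<open>x \<otimes> t\<close> over \<open>z\<close>.\<close>
    obtain t where t: "t \<in> ?B r" "h t = inv\<^bsub>H\<^esub> y \<otimes>\<^bsub>H\<^esub> z"
      using r z y by (metis H.inv_closed H.m_closed)
    have tG: "t \<in> carrier G" using t G.word_ball_subset_carrier by blast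
    show ?thesis
    proof (rule card_inj_on_le[where f = "\<lambda>x. x \<otimes> t"])
      show "inj_on (\<lambda>x. x \<otimes> t) {x \<in> ?B n. h x = y}"
        using tG by (auto simp: inj_on_def word_ball_def)
      show "(\<lambda>x. x \<otimes> t) ` {x \<in> ?B n. h x = y} \<subseteq> A z"
      proof clarify
        fix x assume x: "x \<in> ?B n" "y = h x"
        then have "x \<in> carrier G" using G.word_ball_subset_carrier by blast
        then have "h (x \<otimes> t) = z"
          using tG t x z y by (simp flip: H.m_assoc)
        then show "x \<otimes> t \<in> A z"
          using G.mult_mem_word_ball[OF assms(1) x(1) t(1)] by (simp add: A_def)
      qed
      show "finite (A z)" using fin by (simp add: A_def)
    qed
  qed
  have "order H * card {x \<in> ?B n. h x = y} = (\<Sum>z\<in>carrier H. card {x \<in> ?B n. h x = y})"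
    by (simp add: order_def)
  also have "\<dots> \<le> (\<Sum>z\<in>carrier H. card (A z))"
    by (intro sum_mono le)
  \<comment> \<open>The sets \<open>A z\<close> are disjoint because \<open>h\<close> takes a
    different value on each.\<close>
  also have "\<dots> = card (\<Union>z\<in>carrier H. A z)"
    using fin assms(3) by (intro card_UN_disjoint[symmetric]) (auto simp: A_def)
  also have "\<dots> \<le> card (?B (n + r))"
    using fin by (intro card_mono) (auto simp: A_def)
  finally show ?thesis .
qed

text \<open>Each class of \<open>G\<close> meeting the ball is charged to one of its elements lying
  over a chosen point \<open>rep c\<close>. It then remains to count elements in one fibre for each
  class of \<open>H\<close>.\<close>

lemma (in group_hom) order_mult_card_classes_meeting_ball_le:
  assumes "generating_set G S" "finite S" "finite (carrier H)"
    and r: "\<And>u. u \<in> carrier H \<Longrightarrow> \<exists>t \<in> word_ball G S r. inv t \<in> word_ball G S r \<and> h t = u"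
  shows "order H * card (classes_meeting_ball G S n)
    \<le> card (conjugacy_classes H) * card (word_ball G S (n + 3 * r))"
proof -
  let ?B = "word_ball G S"
  define cl where "cl = orbit G (\<lambda>g. \<lambda>x\<in>carrier G. g \<otimes> x \<otimes> inv g)"
  define rep :: "'c set \<Rightarrow> 'c" where "rep c = (SOME y. y \<in> c)" for c
  define A where "A c = {x \<in> ?B (n + 2 * r). h x = rep c}" for c
  have fin: "finite (?B m)" for m
    by (rule G.finite_word_ball[OF assms(1,2)])
  have union: "\<Union> (conjugacy_classes H) = carrier H"
    unfolding conjugacy_classes_def
    by (rule group_action.orbits_coverture[OF H.action_by_conjugation])
  have fin_cl: "finite (conjugacy_classes H)"
    by (rule finite_UnionD) (simp only: union assms(3))
  have rep: "rep c \<in> c" if "y \<in> c" for c y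
    using that unfolding rep_def by (rule someI)
  \<comment> \<open>Lift to \<open>G\<close> an element of \<open>H\<close> conjugating
    \<open>h x\<close> to \<open>rep c\<close>, and conjugate \<open>x\<close> by that lift.\<close>
  have sub: "classes_meeting_ball G S n \<subseteq> cl ` (\<Union>c\<in>conjugacy_classes H. A c)"
  proof
    fix C assume "C \<in> classes_meeting_ball G S n"
    then obtain x where C: "C \<in> conjugacy_classes G" and x: "x \<in> C" "x \<in> ?B n"
      by (auto simp: classes_meeting_ball_def)
    have xG: "x \<in> carrier G" using x G.word_ball_subset_carrier by blast
    then obtain c where c: "c \<in> conjugacy_classes H" "h x \<in> c"
      using H.conjugacy_class_obtain by (metis hom_closed)
    obtain u where u: "u \<in> carrier H" "rep c = u \<otimes>\<^bsub>H\<^esub> h x \<otimes>\<^bsub>H\<^esub> inv\<^bsub>H\<^esub> u"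
      using H.class_elements_conjugate[OF c rep[OF c(2)]] by blast
    obtain t where t: "t \<in> ?B r" "inv t \<in> ?B r" "h t = u" using r u by blast
    have tG: "t \<in> carrier G" using t G.word_ball_subset_carrier by blast
    \<comment> \<open>Both \<open>t\<close> and \<open>inv t\<close> have length at most
      \<open>r\<close>, whence the radius \<open>n + 2 * r\<close> in \<open>A\<close>.\<close>
    have "t \<otimes> x \<otimes> inv t \<in> ?B (r + n + r)"
      using G.mult_mem_word_ball[OF assms(1)] t x by blast
    moreover have "h (t \<otimes> x \<otimes> inv t) = rep c"
      using u t tG xG by simp
    ultimately have "t \<otimes> x \<otimes> inv t \<in> A c"
      by (simp add: A_def mult_2 add.assoc add.left_commute)
    moreover have "C = cl (t \<otimes> x \<otimes> inv t)"
      unfolding cl_def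
      using G.conjugacy_class_eq[OF C] G.conjugate_mem_class[OF C x(1) tG] by blast
    ultimately show "C \<in> cl ` (\<Union>c\<in>conjugacy_classes H. A c)"
      using c(1) by blast
  qed
  have finA: "finite (\<Union>c\<in>conjugacy_classes H. A c)"
    using fin fin_cl by (auto simp: A_def)
  \<comment> \<open>This ensures that the choice in \<open>rep c\<close> is a genuine element of
    \<open>c\<close>.\<close>
  have nonempty: "\<exists>y. y \<in> c" if "c \<in> conjugacy_classes H" for c
    using that group_action.orbit_refl[OF H.action_by_conjugation]
    unfolding conjugacy_classes_def orbits_def by blast
  \<comment> \<open>Spreading the fibre over all of \<open>H\<close> costs a further
    \<open>r\<close> beyond \<open>n + 2 * r\<close>.\<close>
  have A_le: "order H * card (A c) \<le> card (?B (n + 3 * r))" if c: "c \<in> conjugacy_classes H" for c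
  proof -
    have "rep c \<in> carrier H" using c nonempty rep union by blast
    then have "order H * card (A c) \<le> card (?B (n + 2 * r + r))"
      unfolding A_def using r by (intro order_mult_card_ball_fibre_le[OF assms(1-3)]) blast+
    moreover have "n + 2 * r + r = n + 3 * r" by simp
    ultimately show ?thesis by metis
  qed
  have "card (classes_meeting_ball G S n) \<le> card (\<Union>c\<in>conjugacy_classes H. A c)"
    by (rule surj_card_le[OF finA sub])
  also have "\<dots> \<le> (\<Sum>c\<in>conjugacy_classes H. card (A c))"
    by (rule card_UN_le[OF fin_cl])
  finally have "order H * card (classes_meeting_ball G S n)
      \<le> (\<Sum>c\<in>conjugacy_classes H. order H * card (A c))"
    by (simp flip: sum_distrib_left)
  also have "\<dots> \<le> card (conjugacy_classes H) * card (?B (n + 3 * r))"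
    using sum_bounded_above[of "conjugacy_classes H", OF A_le] by simp
  finally show ?thesis .
qed

text \<open>Finiteness of \<open>H\<close> gives one radius that serves for chosen lifts of all its
  elements and for the inverses of these lifts.\<close>

lemma (in group_hom) bounded_preimages:
  assumes "finite (carrier H)" "h ` carrier G = carrier H"
  obtains r where "\<And>u. u \<in> carrier H \<Longrightarrow> \<exists>t \<in> word_ball G S r. inv t \<in> word_ball G S r \<and> h t = u"
proof -
  define s where "s = inv_into (carrier G) h"
  have s: "s u \<in> carrier G" "h (s u) = u" if "u \<in> carrier H" for u
    using that unfolding s_def assms(2)[symmetric] by (rule inv_into_into, rule f_inv_into_f)
  \<comment> \<open>The sum serves as a common upper bound, since all terms are nonnegative.\<close>
  define r where "r = (\<Sum>u\<in>carrier H. word_length G S (s u) + word_length G S (inv (s u)))"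
  have "word_length G S (s u) + word_length G S (inv (s u)) \<le> r" if "u \<in> carrier H" for u
    unfolding r_def using assms(1) that
    by (intro member_le_sum[of u "carrier H" "\<lambda>u. word_length G S (s u) + word_length G S (inv (s u))"]) auto
  then have "s u \<in> word_ball G S r \<and> inv (s u) \<in> word_ball G S r" if "u \<in> carrier H" for u
    using that s[OF that] by (fastforce simp: word_ball_def)
  with s that show thesis by blast
qed

section \<open>Passage to the limit\<close>

theorem (in group_hom) conjugacy_ratio_le:
  assumes "generating_set G S" "finite S" "stable_subexp_growth G S"
    and "finite (carrier H)" "h ` carrier G = carrier H"
  shows "conjugacy_ratio G S \<le> ereal (degree_of_commutativity H)"
proof -
  let ?b = "\<lambda>n. real (card (word_ball G S n))"
  let ?c = "\<lambda>n. real (card (classes_meeting_ball G S n))"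
  let ?d = "degree_of_commutativity H"
  obtain r where r: "\<And>u. u \<in> carrier H \<Longrightarrow>
      \<exists>t \<in> word_ball G S r. inv t \<in> word_ball G S r \<and> h t = u"
    using bounded_preimages[OF assms(4,5)] by blast
  have le: "?c n / ?b n \<le> ?d * (?b (n + 3 * r) / ?b n)" for n
  proof -
    have "real (order H) * ?c n \<le> real (card (conjugacy_classes H)) * ?b (n + 3 * r)"
      using order_mult_card_classes_meeting_ball_le[OF assms(1,2,4) r, of n]
      by (metis of_nat_le_iff of_nat_mult)
    moreover have "0 < order H"
      using assms(4) H.order_gt_0_iff_finite by blast
    \<comment> \<open>Dividing by \<open>order H\<close> turns the number of classes of
      \<open>H\<close> into \<open>?d\<close>, by Burnside's lemma.\<close>
    ultimately have "?c n \<le> ?d * ?b (n + 3 * r)"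
      unfolding H.degree_of_commutativity_eq[OF assms(4)] by (simp add: field_simps)
    then show ?thesis by (simp add: divide_right_mono)
  qed
  \<comment> \<open>The radius \<open>r\<close> does not depend on \<open>n\<close>, so stable
    growth absorbs the fixed shift \<open>3 * r\<close>.\<close>
  have "(\<lambda>n. ?d * (?b (n + 3 * r) / ?b n)) \<longlonglongrightarrow> ?d"
    using tendsto_mult_left[OF G.stable_subexp_growth_shift[OF assms(1-3), of "3 * r"], of ?d] by simp
  then have "limsup (\<lambda>n. ereal (?d * (?b (n + 3 * r) / ?b n))) = ereal ?d"
    by (intro lim_imp_Limsup) (auto intro: tendsto_ereal)
  moreover have "conjugacy_ratio G S \<le> limsup (\<lambda>n. ereal (?d * (?b (n + 3 * r) / ?b n)))"
    unfolding conjugacy_ratio_def using le by (intro Limsup_mono) auto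
  ultimately show ?thesis by simp
qed

theorem proposition3p6:
  fixes G :: "('a, 'b) monoid_scheme" and N S :: "'a set"
  assumes "group G"
    and "N \<lhd> G" and "finite (rcosets\<^bsub>G\<^esub> N)"
    and "finite S" and "generating_set G S"
    and "stable_subexp_growth G S"
  shows "conjugacy_ratio G S \<le> ereal (degree_of_commutativity (G Mod N))"
proof -
  interpret N: normal N G by fact
  \<comment> \<open>The general bound is applied to the projection onto the quotient. It is onto,
    and its target is finite because \<open>N\<close> has finite index.\<close>
  interpret group_hom G "G Mod N" "\<lambda>g. N #>\<^bsub>G\<^esub> g"
    by (intro group_hom.intro group_hom_axioms.intro assms(1) N.factorgroup_is_group N.r_coset_hom_Mod)
  show ?thesis
    using assms by (intro conjugacy_ratio_le) (auto simp: carrier_FactGroup RCOSETS_def FactGroup_def)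
qed

end
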